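(* Let $h\ge 2$ be an integer and let $q$ be a power of a prime $p$. (Bose–Chowla sets) Let $\theta$ be the fixed generator of $\mathbb{F}_{q^h}^\times$, and let $b,e$ be integers such that $\theta^b$ and $\theta^e$ both have algebraic degree $h$ over $\mathbb{F}_q$. If at least one of the following holds: (i) $b\equiv e \pmod{\frac{q^h-1}{q-1}}$, (ii) $\theta^b-\theta^e\in\mathbb{F}_q$, (iii) $b\equiv p^i e\pmod{q^h-1}$ for some integer $i$, then $\mathrm{BoseCh}_h(q,b)\sim\mathrm{BoseCh}_h(q,e)$ (affine equivalence in $\mathbb{Z}/(q^h-1)\mathbb{Z}$). (Singer sets) Let $\theta$ be the fixed generator of $\mathbb{F}_{q^{h+1}}^\times$, and let $b,e$ be integers such that $\theta^b$ and $\theta^e$ both have algebraic degree $h+1$ over $\mathbb{F}_q$. If at least one of the following holds: (iv) $b\equiv e\pmod{\frac{q^{h+1}-1}{q-1}}$, (v) $b\equiv p^i e\pmod{q^{h+1}-1}$ for some integer $i$, (vi) $\theta^b-\theta^e\in\mathbb{F}_q$, (vii) $r\theta^b+t\theta^{e+b}+w\theta^e\in\mathbb{F}_q$ for some $r,t,w\in\mathbb{F}_q$ with $r,t$ not both $0$, then $\mathrm{Singer}_h(q,b)\sim\mathrm{Singer}_h(q,e)$ (affine equivalence in $\mathbb{Z}/\frac{q^{h+1}-1}{q-1}\mathbb{Z}$).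
   Context: Two sets $\mathcal{A}_1,\mathcal{A}_2\subseteq\mathbb{Z}/M\mathbb{Z}$ are affinely equivalent, written $\mathcal{A}_1\sim\mathcal{A}_2$, if there are some $d$ relatively prime to $M$ and some $s$ with $\mathcal{A}_2=\{da+s : a\in\mathcal{A}_1\}$. Choice of generator: for each finite field $\mathbb{F}_{p^n}$ ($p$ prime) a generator $\theta$ of the cyclic group $\mathbb{F}_{p^n}^\times$ is fixed once and for all, namely a root of the Conway polynomial $C_{p,n}\in\mathbb{F}_p[x]$. The only properties of Conway polynomials that are used are that $C_{p,n}$ is uniquely determined by $p,n$, is irreducible over $\mathbb{F}_p$ with $\mathbb{F}_p[x]/(C_{p,n})\cong\mathbb{F}_{p^n}$, and that its root $\theta$ generates $\mathbb{F}_{p^n}^\times$. $\mathrm{BoseCh}_h(q,b)$: set $M=q^h-1$, let $\theta$ be the fixed generator of $\mathbb{F}_{q^h}^\times$, and let $b$ (an integer, or its class modulo $M$) be such that $\theta^b$ has algebraic degree $h$ over $\mathbb{F}_q$. Then $$\mathrm{BoseCh}_h(q,b):=\{a\in\mathbb{Z}/M\mathbb{Z} : \theta^a=\theta^b+v \text{ for some } v\in\mathbb{F}_q\}.$$ $\mathrm{Singer}_h(q,b)$: set $M=\frac{q^{h+1}-1}{q-1}$, let $\theta$ be the fixed generator of $\mathbb{F}_{q^{h+1}}^\times$, and let $b$ (an integer, or its class modulo $M$) be such that $\theta^b$ has algebraic degree $h+1$ over $\mathbb{F}_q$. Then $$\mathrm{Singer}_h(q,b):=\{a\in\mathbb{Z}/M\mathbb{Z}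 : \theta^a=u\theta^b+v \text{ for some } u,v\in\mathbb{F}_q\}.$$ Since $\theta^{M}\in\mathbb{F}_q^\times$, the condition does not depend on the integer representatives chosen for $a,b$ modulo $M$. *)

theory Defs
  imports "HOL-Number_Theory.Residues" "HOL-Algebra.Finite_Extensions" "HOL-Algebra.Generated_Groups"
begin

(* Subsets of Z/MZ are represented by their sets of least nonnegative residues. *)
definition affinely_equivalent :: "int \<Rightarrow> int set \<Rightarrow> int set \<Rightarrow> bool" where
  "affinely_equivalent M A B \<longleftrightarrow>
     A \<subseteq> {0..<M} \<and> B \<subseteq> {0..<M} \<and>
     (\<exists>d s. coprime d M \<and> B = (\<lambda>a. (d * a + s) mod M) ` A)"

(* K is a field with q^n elements, F its subfield with q elements, and \<theta> a generator of the
   multiplicative group of K.  A convention singling out one generator for each field (such as a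
   root of the Conway polynomial) is an instance: \<theta> is an arbitrary but fixed generator. *)
locale finite_field_generator = field K
  for K :: "('a, 'm) ring_scheme" (structure) +
  fixes F :: "'a set" and \<theta> :: 'a and q n :: nat
  assumes order_K: "order K = q ^ n"
    and subfield_F: "subfield F K"
    and card_F: "card F = q"
    and gen_in_units: "\<theta> \<in> carrier (units_of K)"
    and gen_generates: "generate (units_of K) {\<theta>} = carrier (units_of K)"

(* The degree of the minimal polynomial of x over the subfield F; Irr is only meaningful for
   algebraic x, which is automatic when K is finite. *)
definition algebraic_degree :: "('a, 'm) ring_scheme \<Rightarrow> 'a set \<Rightarrow> 'a \<Rightarrow> nat" where
  "algebraic_degree K F x = Polynomials.degree (ring.Irr K F x)"

definition BoseCh ::
  "('a, 'm) ring_scheme \<Rightarrow> 'a set \<Rightarrow> 'a \<Rightarrow> nat \<Rightarrow> nat \<Rightarrow> int \<Rightarrow> int set" where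
  "BoseCh K F \<theta> h q b =
     {a \<in> {0..<int q ^ h - 1}.
        \<exists>v\<in>F. \<theta> [^]\<^bsub>units_of K\<^esub> a = \<theta> [^]\<^bsub>units_of K\<^esub> b \<oplus>\<^bsub>K\<^esub> v}"

definition Singer ::
  "('a, 'm) ring_scheme \<Rightarrow> 'a set \<Rightarrow> 'a \<Rightarrow> nat \<Rightarrow> nat \<Rightarrow> int \<Rightarrow> int set" where
  "Singer K F \<theta> h q b =
     {a \<in> {0..<(int q ^ (h + 1) - 1) div (int q - 1)}.
        \<exists>u\<in>F. \<exists>v\<in>F. \<theta> [^]\<^bsub>units_of K\<^esub> a = u \<otimes>\<^bsub>K\<^esub> \<theta> [^]\<^bsub>units_of K\<^esub> b \<oplus>\<^bsub>K\<^esub> v}"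

(* b = p^i * e (mod M) for some integer i.  For p coprime to M a negative power of p is a power
   of the inverse of p modulo M; multiplying it out gives the second alternative. *)
definition cong_power_multiple :: "nat \<Rightarrow> int \<Rightarrow> int \<Rightarrow> int \<Rightarrow> bool" where
  "cong_power_multiple p M b e \<longleftrightarrow>
     (\<exists>i::nat. [b = int p ^ i * e] (mod M) \<or> [int p ^ i * b = e] (mod M))"

end

theory Submission
  imports Defs
begin

text \<open>
  A Bose--Chowla set with parameter \<open>b\<close> records the exponents of the field elements in the
  coset \<open>\<theta>\<^sup>b + F\<close>; a Singer set records the exponents of the nonzero elements in the plane
  \<open>F \<theta>\<^sup>b + F\<close>.  On exponents, multiplication by \<open>\<theta>\<^sup>s\<close> is the translation by \<open>s\<close>, and the
  Frobenius power \<open>x \<mapsto> x\<^sup>P\<close> with \<open>P = p\<^sup>i\<close> is the dilation by \<open>P\<close>.  Hence two such sets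
  are affinely equivalent as soon as a map of one of these kinds carries the one coset or plane
  onto the other.  Onto-ness costs nothing, because every map that occurs is presented together
  with its inverse, which is a map of the same kind (lemma \<open>affinely_equivalentI_inverse\<close>).

  If \<open>b\<close> is congruent to \<open>p\<^sup>i e\<close>, the map is the Frobenius power.  It is additive and
  preserves \<open>F\<close>, and its inverse is again a Frobenius power, since the exponent
  \<open>p\<^sup>k\<^sup>n = q\<^sup>n\<close>, where \<open>q = p\<^sup>k\<close>, acts as the identity (lemma \<open>frobenius_conjugates\<close>).

  For Bose--Chowla sets, the cosets are equal if \<open>\<theta>\<^sup>b - \<theta>\<^sup>e\<close> lies in \<open>F\<close>.  The congruence of
  \<open>b\<close> and \<open>e\<close> modulo \<open>(q\<^sup>n - 1) / (q - 1)\<close> is used through the fact that \<open>\<theta>\<^sup>j\<close> lies in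
  \<open>F\<close> exactly when \<open>j\<close> is a multiple of this number (lemma \<open>pw_in_F_iff\<close>):
  then \<open>\<theta>\<^sup>b = c \<theta>\<^sup>e\<close> with \<open>c\<close> in \<open>F\<close>, and multiplication by \<open>c\<close> maps one coset to the other.

  For Singer sets the heart is the bilinear relation between \<open>B = \<theta>\<^sup>b\<close> and \<open>E = \<theta>\<^sup>e\<close>.  If
  \<open>r B + t E B + w E = z\<close> with \<open>r, t, w, z\<close> in \<open>F\<close>, then \<open>B = (z - w E) / (r + t E)\<close> is a
  Moebius transform of \<open>E\<close>, so multiplication by \<open>r + t E\<close> maps the plane \<open>F B + F\<close> into the
  plane \<open>F E + F\<close>.  The relation is symmetric under exchanging \<open>(B, r)\<close> with \<open>(E, w)\<close>, so
  multiplication by \<open>w + t B\<close> maps the second plane into the first.  The product of the two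
  multipliers is \<open>r w + t z\<close>, the determinant of the transform up to sign, which is in \<open>F\<close>;
  so their exponents are opposite modulo \<open>(q\<^sup>n - 1) / (q - 1)\<close>, which is what makes the two
  translations inverse to each other.  Both multipliers are nonzero because \<open>B\<close> and \<open>E\<close> have
  degree at least 2 and hence are not in \<open>F\<close>.  The conditions \<open>\<theta>\<^sup>b = c \<theta>\<^sup>e\<close> with \<open>c\<close>
  in \<open>F\<close> and \<open>\<theta>\<^sup>b - \<theta>\<^sup>e\<close> in \<open>F\<close> are the cases \<open>t = 0\<close>, \<open>r = 1\<close> and \<open>w = -c\<close> or \<open>w = -1\<close>.
\<close>

section \<open>Affine equivalence of sets of residues\<close>

text \<open>
  Two inclusions suffice if they are given by affine maps that are inverse to each other modulo
  \<open>M\<close>: the first two congruences say that \<open>a \<mapsto> d a + s\<close> after \<open>b \<mapsto> d' b + s'\<close> is the identity.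
  The first of them also makes \<open>d\<close> a unit modulo \<open>M\<close>.
\<close>

lemma affinely_equivalentI_inverse:
  fixes M d d' s s' :: int
  assumes A: "A \<subseteq> {0..<M}" and B: "B \<subseteq> {0..<M}"
    and dd': "[d * d' = 1] (mod M)" and ss': "[d * s' + s = 0] (mod M)"
    and AB: "\<And>a. a \<in> A \<Longrightarrow> (d * a + s) mod M \<in> B"
    and BA: "\<And>b. b \<in> B \<Longrightarrow> (d' * b + s') mod M \<in> A"
  shows "affinely_equivalent M A B"
proof -
  have "coprime d M"
    using dd' coprime_iff_invertible_int by blast
  moreover have "B = (\<lambda>a. (d * a + s) mod M) ` A"
  proof
    show "B \<subseteq> (\<lambda>a. (d * a + s) mod M) ` A"
    proof
      fix b assume b: "b \<in> B"
      have "[d * ((d' * b + s') mod M) + s = d * (d' * b + s') + s] (mod M)"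
        by (intro cong_add cong_mult) (simp_all add: cong_def)
      also have "d * (d' * b + s') + s = (d * d') * b + (d * s' + s)"
        by (simp add: algebra_simps)
      also have "[\<dots> = 1 * b + 0] (mod M)"
        by (intro cong_add cong_mult dd' ss') simp_all
      finally have "(d * ((d' * b + s') mod M) + s) mod M = b mod M"
        by (simp add: cong_def)
      also have "b mod M = b"
        using B b by auto
      finally show "b \<in> (\<lambda>a. (d * a + s) mod M) ` A"
        using BA[OF b] by (intro image_eqI[where x = "(d' * b + s') mod M"]) simp_all
    qed
  qed (use AB in auto)
  ultimately show ?thesis
    unfolding affinely_equivalent_def using A B by blast
qed

section \<open>The Frobenius map in characteristic p\<close>

text \<open>
  By induction on \<open>n\<close>: multiplying the sum for \<open>n\<close> by \<open>x\<close> raises the power of \<open>x\<close>, multiplying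
  it by \<open>y\<close> does not, and Pascal's rule collects the two.
\<close>

lemma (in cring) binomial_theorem:
  assumes x: "x \<in> carrier R" and y: "y \<in> carrier R"
  shows "(x \<oplus> y) [^] (n::nat) = (\<Oplus>k\<in>{..n}. [(n choose k)] \<cdot> (x [^] k \<otimes> y [^] (n - k)))"
proof (induction n)
  case 0
  then show ?case by simp
next
  case (Suc n)
  define S where "S = (\<Oplus>k\<in>{..n}. [(n choose k)] \<cdot> (x [^] k \<otimes> y [^] (n - k)))"
  (* f c k is the term of index Suc k for n + 1, with the coefficient c left open, so that
     Pascal's rule becomes additivity in c. *)
  define f where "f c k = [c] \<cdot> (x [^] Suc k \<otimes> y [^] (n - k))" for c k :: nat
  have f_closed: "f c k \<in> carrier R" for c k
    using x y by (simp add: f_def)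
  have Sx: "x \<otimes> S = (\<Oplus>k\<in>{..n}. f (n choose k) k)"
    unfolding S_def using x y
    by (subst finsum_rdistr)
      (auto intro!: finsum_cong' simp: f_def add_pow_rdistr m_ac)
  have "y \<otimes> S = (\<Oplus>k\<in>{..n}. [(n choose k)] \<cdot> (x [^] k \<otimes> y [^] (Suc n - k)))"
    unfolding S_def using x y
    by (subst finsum_rdistr)
      (auto intro!: finsum_cong' simp: add_pow_rdistr m_ac Suc_diff_le)
  (* The added term has coefficient n choose (n + 1) = 0. *)
  also have "\<dots> = (\<Oplus>k\<in>{..Suc n}. [(n choose k)] \<cdot> (x [^] k \<otimes> y [^] (Suc n - k)))"
    using x y by (simp add: Pi_def binomial_eq_0)
  also have "\<dots> = (\<Oplus>k\<in>{..n}. f (n choose Suc k) k) \<oplus> y [^] Suc n"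
    using x y by (subst finsum_Suc2) (auto simp: f_def)
  finally have Sy: "y \<otimes> S = (\<Oplus>k\<in>{..n}. f (n choose Suc k) k) \<oplus> y [^] Suc n" .
  have fsum: "f (n choose k) k \<oplus> f (n choose Suc k) k = f (Suc n choose Suc k) k" for k
    using x y by (simp add: f_def add.nat_pow_mult)
  have S_closed: "S \<in> carrier R"
    unfolding S_def using x y by (intro finsum_closed) auto
  have "(x \<oplus> y) [^] Suc n = x \<otimes> S \<oplus> y \<otimes> S"
    using x y Suc.IH S_closed by (simp add: S_def[symmetric] m_comm[of S] l_distr)
  also have "\<dots> = (\<Oplus>k\<in>{..n}. f (n choose k) k \<oplus> f (n choose Suc k) k) \<oplus> y [^] Suc n"
    using f_closed y unfolding Sx Sy
    by (subst finsum_addf) (auto simp: a_assoc Pi_def)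
  also have "\<dots> = (\<Oplus>k\<in>{..n}. f (Suc n choose Suc k) k) \<oplus> y [^] Suc n"
    by (simp only: fsum)
  also have "\<dots> = (\<Oplus>k\<in>{..Suc n}. [(Suc n choose k)] \<cdot> (x [^] k \<otimes> y [^] (Suc n - k)))"
    using x y by (subst finsum_Suc2) (auto simp: f_def)
  finally show ?case .
qed

text \<open>
  All binomial coefficients except the two outer ones are divisible by \<open>p\<close>.
\<close>

lemma (in cring) frobenius_add:
  fixes p :: nat
  assumes p: "Factorial_Ring.prime p" and char: "\<And>z. z \<in> carrier R \<Longrightarrow> [p] \<cdot> z = \<zero>"
    and x: "x \<in> carrier R" and y: "y \<in> carrier R"
  shows "(x \<oplus> y) [^] p = x [^] p \<oplus> y [^] p"
proof -
  obtain n where n: "p = Suc (Suc n)"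
    using prime_ge_2_nat[OF p] by (metis add_2_eq_Suc le_Suc_ex)
  let ?f = "\<lambda>k. [(p choose k)] \<cdot> (x [^] k \<otimes> y [^] (p - k))"
  have closed: "?f k \<in> carrier R" for k
    using x y by simp
  have vanish: "?f (Suc k) = \<zero>" if "k \<le> n" for k
  proof -
    have "p dvd p choose Suc k"
      using that n p by (intro dvd_choose_prime) auto
    then obtain c where c: "p choose Suc k = p * c" ..
    show ?thesis
      unfolding c using x y
      by (subst add.nat_pow_pow[symmetric]) (auto simp: char)
  qed
  have "(x \<oplus> y) [^] p = (\<Oplus>k\<in>{..Suc (Suc n)}. ?f k)"
    using binomial_theorem[OF x y, of p] n by simp
  also have "\<dots> = ?f p \<oplus> ((\<Oplus>k\<in>{..n}. ?f (Suc k)) \<oplus> ?f 0)"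
    using closed n by (subst finsum_Suc, simp, subst finsum_Suc2) auto
  also have "(\<Oplus>k\<in>{..n}. ?f (Suc k)) = \<zero>"
    using vanish by (intro add.finprod_one_eqI) auto
  finally show ?thesis
    using x y by simp
qed

lemma (in cring) frobenius_iter_add:
  fixes p :: nat
  assumes p: "Factorial_Ring.prime p" and char: "\<And>z. z \<in> carrier R \<Longrightarrow> [p] \<cdot> z = \<zero>"
    and x: "x \<in> carrier R" and y: "y \<in> carrier R"
  shows "(x \<oplus> y) [^] (p ^ i) = x [^] (p ^ i) \<oplus> y [^] (p ^ i)"
proof (induction i)
  case 0
  then show ?case using x y by simp
next
  case (Suc i)
  have "(x \<oplus> y) [^] (p ^ Suc i) = ((x \<oplus> y) [^] (p ^ i)) [^] p"
    using x y by (simp add: nat_pow_pow mult.commute)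
  also have "\<dots> = (x [^] (p ^ i)) [^] p \<oplus> (y [^] (p ^ i)) [^] p"
    using Suc.IH frobenius_add[OF p char] x y by simp
  also have "\<dots> = x [^] (p ^ Suc i) \<oplus> y [^] (p ^ Suc i)"
    using x y by (simp add: nat_pow_pow mult.commute)
  finally show ?case .
qed

text \<open>
  By Lagrange's theorem for the additive group, \<open>p\<^sup>j\<close> times 1 vanishes; this is the \<open>j\<close>-th power
  of \<open>p\<close> times 1, and a field has no nilpotent elements.
\<close>

lemma (in field) characteristic_of_finite_field:
  fixes p j :: nat
  assumes order: "order R = p ^ j" and z: "z \<in> carrier R"
  shows "[p] \<cdot> z = \<zero>"
proof -
  have pow: "([p] \<cdot> \<one>) [^] i = [(p ^ i)] \<cdot> \<one>" for i :: nat
  proof (induction i)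
    case (Suc i)
    then show ?case
      by (simp add: add_pow_ldistr add_pow_rdistr add.nat_pow_pow mult.commute)
  qed simp
  have "[(order R)] \<cdot> \<one> = \<zero>"
    using add.pow_order_eq_1[of \<one>] by (simp add: order_def)
  then have "([p] \<cdot> \<one>) [^] j = \<zero>"
    using order pow by simp
  then have p1: "[p] \<cdot> \<one> = \<zero>"
  proof (induction j)
    case (Suc j)
    then show ?case
      using integral[of "([p] \<cdot> \<one>) [^] j" "[p] \<cdot> \<one>"] by auto
  qed simp
  have "[p] \<cdot> z = ([p] \<cdot> \<one>) \<otimes> z"
    using z by (simp add: add_pow_ldistr)
  then show ?thesis
    using p1 z by simp
qed

section \<open>Powers of the generator\<close>

text \<open>
  The prime \<open>p\<close> is the characteristic of both fields; it is made a parameter because the Frobenius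
  map is stated in terms of it.
\<close>

locale prime_power_field_generator = finite_field_generator +
  fixes p k :: nat
  assumes prime_p: "Factorial_Ring.prime p" and k_pos: "k \<ge> 1" and q_eq: "q = p ^ k"
begin

sublocale units: comm_group "units_of K"
  by (rule units_comm_group)

definition pw :: "int \<Rightarrow> 'a" where
  "pw a = \<theta> [^]\<^bsub>units_of K\<^esub> a"

text \<open>
  With \<open>n\<close> the degree of \<open>K\<close> over \<open>F\<close>, these are the order of the unit group of \<open>K\<close> and the
  index in it of the unit group of \<open>F\<close>.  Bose--Chowla sets use the first with \<open>h = n\<close>, Singer
  sets the second with \<open>h + 1 = n\<close>.
\<close>

definition bose_modulus :: int where "bose_modulus = int q ^ n - 1"

definition singer_modulus :: int where "singer_modulus = (int q ^ n - 1) div (int q - 1)"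

lemma q_ge_2: "q \<ge> 2"
  using prime_ge_2_nat[OF prime_p] k_pos unfolding q_eq
  by (metis le_trans one_le_numeral power_increasing power_one_right)

lemma finite_K: "finite (carrier K)"
  using order_K q_ge_2 unfolding order_def by (intro card_ge_0_finite) simp

lemma F_subset: "F \<subseteq> carrier K"
  using subfield_F by (rule subfieldE(3))

lemma subring_F: "subring F K"
  using subfield_F by (rule subfieldE(1))

lemmas F_closed [simp] =
  subringE(2,3,5,6,7)[OF subring_F] subsetD[OF F_subset]

lemma F_minus_closed [simp]: "x \<in> F \<Longrightarrow> y \<in> F \<Longrightarrow> x \<ominus> y \<in> F"
  by (simp add: a_minus_def)

lemma F_pow_closed [simp]: "x \<in> F \<Longrightarrow> x [^] (i::nat) \<in> F"
  by (induction i) auto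

lemma F_cancel: "x \<in> F \<Longrightarrow> x \<noteq> \<zero> \<Longrightarrow> y \<in> carrier K \<Longrightarrow> x \<otimes> y \<in> F \<Longrightarrow> y \<in> F"
  using subfield_m_inv_simprule[OF subfield_F, of x y] by simp

lemma carrier_units: "carrier (units_of K) = carrier K - {\<zero>}"
  by (simp add: units_of_carrier field_Units)

lemma pw_nonzero: "pw a \<in> carrier K - {\<zero>}"
  unfolding pw_def carrier_units[symmetric] using gen_in_units by simp

lemma pw_closed [simp]: "pw a \<in> carrier K" and pw_not_zero [simp]: "pw a \<noteq> \<zero>"
  using pw_nonzero by auto

lemma pw_add: "pw (a + b) = pw a \<otimes> pw b"
  unfolding pw_def using gen_in_units by (simp add: units.int_pow_mult units_of_mult)

lemma pw_0 [simp]: "pw 0 = \<one>"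
  by (simp add: pw_def units_of_one)

lemma pw_mult_nat: "pw (int i * a) = pw a [^] i"
proof -
  have "pw a \<in> Units K"
    using pw_nonzero by (simp add: field_Units)
  have "pw (int i * a) = (\<theta> [^]\<^bsub>units_of K\<^esub> a) [^]\<^bsub>units_of K\<^esub> (int i)"
    unfolding pw_def using gen_in_units by (simp add: units.int_pow_pow mult.commute)
  also have "\<dots> = pw a [^] i"
    using \<open>pw a \<in> Units K\<close> by (simp add: int_pow_int pw_def units_of_pow)
  finally show ?thesis .
qed

lemma pw_surj: "x \<in> carrier K \<Longrightarrow> x \<noteq> \<zero> \<Longrightarrow> \<exists>a. x = pw a"
  using gen_generates units.generate_pow[OF gen_in_units] unfolding carrier_units pw_def
  by blast

lemma int_ord_generator: "int (units.ord \<theta>) = bose_modulus"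
proof -
  have "units.ord \<theta> = card (carrier K - {\<zero>})"
    using units.generate_pow_card[OF gen_in_units] gen_generates carrier_units by simp
  also have "\<dots> = q ^ n - 1"
    using order_K finite_K by (simp add: order_def)
  finally show ?thesis
    using q_ge_2 by (simp add: bose_modulus_def of_nat_diff)
qed

lemma pw_eq_iff: "pw a = pw b \<longleftrightarrow> [a = b] (mod bose_modulus)"
  unfolding pw_def units.int_pow_eq[OF gen_in_units] int_ord_generator
  by (metis cong_iff_dvd_diff cong_sym_eq)

lemma pw_mod [simp]: "pw (a mod bose_modulus) = pw a"
  by (simp add: pw_eq_iff)

lemma singer_modulus_times: "singer_modulus * (int q - 1) = bose_modulus"
proof -
  have "int q - 1 dvd int q ^ n - 1"
    by (simp add: power_diff_1_eq)
  then show ?thesis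
    by (simp add: singer_modulus_def bose_modulus_def)
qed

lemma pw_singer_modulus_times_mod: "pw (singer_modulus * (c mod (int q - 1))) = pw (singer_modulus * c)"
proof -
  have "singer_modulus * (c mod (int q - 1)) = (singer_modulus * c) mod bose_modulus"
    unfolding singer_modulus_times[symmetric] by (rule mult_mod_right)
  then show ?thesis
    by simp
qed

lemma n_pos: "n > 0"
proof (rule ccontr)
  assume "\<not> n > 0"
  then have "card (carrier K) = 1"
    using order_K by (simp add: order_def)
  moreover have "card {\<zero>, \<one>} \<le> card (carrier K)"
    using finite_K by (intro card_mono) auto
  ultimately show False
    by simp
qed

lemma bose_modulus_pos: "bose_modulus > 0"
  using q_ge_2 n_pos by (simp add: bose_modulus_def)

lemma singer_modulus_pos: "singer_modulus > 0"
  using singer_modulus_times bose_modulus_pos q_ge_2 zero_less_mult_pos2[of singer_modulus "int q - 1"] by simp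

lemma F_unit_pow: "x \<in> F \<Longrightarrow> x \<noteq> \<zero> \<Longrightarrow> x [^] (q - 1) = \<one>"
proof -
  assume x: "x \<in> F" "x \<noteq> \<zero>"
  interpret F: field "K\<lparr>carrier := F\<rparr>"
    using subfield_iff(2)[OF subfield_F] .
  have Units: "Units (K\<lparr>carrier := F\<rparr>) = F - {\<zero>}"
    using F.field_Units by simp
  have "finite F"
    using F_subset finite_K by (rule finite_subset)
  then have "x [^]\<^bsub>K\<lparr>carrier := F\<rparr>\<^esub> card (F - {\<zero>}) = \<one>"
    using F.units_power_order_eq_one[of x] x unfolding Units by simp
  then show ?thesis
    using card_F \<open>finite F\<close> by (simp add: nat_pow_def)
qed

text \<open>
  A nonzero element \<open>\<theta>\<^sup>j\<close> of \<open>F\<close> has order dividing \<open>q - 1\<close>, which makes \<open>j\<close> a multiple of the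
  Singer modulus.  This gives one inclusion; the reverse one follows by counting, since the left
  side has \<open>q - 1\<close> elements and the right side at most as many.
\<close>

lemma F_units_eq: "F - {\<zero>} = (\<lambda>i. pw (singer_modulus * i)) ` {0..<int q - 1}"
proof (rule card_seteq)
  show "finite ((\<lambda>i. pw (singer_modulus * i)) ` {0..<int q - 1})"
    by simp
  show "F - {\<zero>} \<subseteq> (\<lambda>i. pw (singer_modulus * i)) ` {0..<int q - 1}"
  proof
    fix x assume x: "x \<in> F - {\<zero>}"
    then obtain j where j: "x = pw j"
      using pw_surj[of x] by auto
    have "pw (int (q - 1) * j) = pw 0"
      using F_unit_pow[of x] x by (simp add: pw_mult_nat j)
    then have "singer_modulus * (int q - 1) dvd j * (int q - 1)"
      using q_ge_2 unfolding pw_eq_iff singer_modulus_times by (simp add: cong_0_iff of_nat_diff mult.commute)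
    then obtain c where c: "j = singer_modulus * c"
      using q_ge_2 by (auto simp del: mult_cancel_right simp: dvd_times_right_cancel_iff)
    then have "x = pw (singer_modulus * (c mod (int q - 1)))"
      by (simp add: j pw_singer_modulus_times_mod)
    moreover have "c mod (int q - 1) \<in> {0..<int q - 1}"
      using q_ge_2 by simp
    ultimately show "x \<in> (\<lambda>i. pw (singer_modulus * i)) ` {0..<int q - 1}"
      by blast
  qed
  have "card ((\<lambda>i. pw (singer_modulus * i)) ` {0..<int q - 1}) \<le> q - 1"
    using card_image_le[of "{0..<int q - 1}" "\<lambda>i. pw (singer_modulus * i)"] by simp
  also have "q - 1 = card (F - {\<zero>})"
    using card_F finite_subset[OF F_subset finite_K] by simp
  finally show "card ((\<lambda>i. pw (singer_modulus * i)) ` {0..<int q - 1}) \<le> card (F - {\<zero>})" .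
qed

lemma pw_in_F_iff: "pw j \<in> F \<longleftrightarrow> singer_modulus dvd j"
proof
  assume "pw j \<in> F"
  then obtain i where "pw j = pw (singer_modulus * i)"
    using F_units_eq by (metis (no_types, lifting) Diff_iff imageE pw_not_zero singletonD)
  then have "singer_modulus dvd j - singer_modulus * i"
    unfolding pw_eq_iff cong_iff_dvd_diff singer_modulus_times[symmetric] by (rule dvd_mult_left)
  then have "singer_modulus dvd j - singer_modulus * i + singer_modulus * i"
    by (rule dvd_add) simp
  then show "singer_modulus dvd j"
    by simp
next
  assume "singer_modulus dvd j"
  then obtain c where c: "j = singer_modulus * c" ..
  then have "pw j = pw (singer_modulus * (c mod (int q - 1)))"
    by (simp add: pw_singer_modulus_times_mod)
  moreover have "c mod (int q - 1) \<in> {0..<int q - 1}"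
    using q_ge_2 by simp
  ultimately have "pw j \<in> F - {\<zero>}"
    unfolding F_units_eq by blast
  then show "pw j \<in> F"
    by simp
qed

text \<open>
  An element \<open>x\<close> of \<open>F\<close> is a root of the linear polynomial \<open>X - x\<close> over \<open>F\<close>.
\<close>

lemma not_in_F_of_degree:
  assumes "algebraic_degree K F x \<ge> 2"
  shows "x \<notin> F"
proof
  assume x: "x \<in> F"
  then have xK: "x \<in> carrier K" and alg: "(algebraic over F) x"
    using algebraic_self[OF subring_F] by auto
  let ?p = "[\<one>, \<ominus> x]"
  have p: "?p \<in> carrier (F[X])"
    using x by (simp add: univ_poly_def polynomial_def)
  have "eval ?p x = \<zero>"
    using xK by (simp add: r_neg)
  then have "Irr F x pdivides ?p"
    using Irr_minimal[OF subfield_F xK alg p] by simp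
  then have "Polynomials.degree (Irr F x) \<le> Polynomials.degree ?p"
    using pdivides_imp_degree_le[OF subring_F IrrE(1)[OF subfield_F xK alg] p] by simp
  then show False
    using assms by (simp add: algebraic_degree_def)
qed

lemma frobenius_power_add:
  assumes "x \<in> carrier K" "y \<in> carrier K"
  shows "(x \<oplus> y) [^] (p ^ i) = x [^] (p ^ i) \<oplus> y [^] (p ^ i)"
proof (rule frobenius_iter_add[OF prime_p _ assms])
  show "[p] \<cdot> z = \<zero>" if "z \<in> carrier K" for z
    using characteristic_of_finite_field[of p "k * n" z] that order_K
    by (simp add: q_eq power_mult)
qed

text \<open>
  The exponent \<open>p\<^sup>k\<^sup>n = q\<^sup>n\<close> is 1 modulo \<open>q\<^sup>n - 1\<close>, so that \<open>p\<^sup>i\<close> can be completed to the \<open>i\<close>-th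
  power of \<open>q\<^sup>n\<close> by a nonnegative power of \<open>p\<close>.
\<close>

lemma frobenius_inverse: "\<exists>i'. [int p ^ i * int p ^ i' = 1] (mod bose_modulus)"
proof -
  have "k * n \<ge> 1"
    using k_pos n_pos by (simp add: Suc_leI)
  then have "i + (i * (k * n) - i) = i * (k * n)"
    by (cases "k * n") auto
  then have "int p ^ i * int p ^ (i * (k * n) - i) = (int q ^ n) ^ i"
    by (simp add: q_eq mult.commute mult.left_commute flip: power_add power_mult)
  moreover have "[(int q ^ n) ^ i = 1 ^ i] (mod bose_modulus)"
    by (intro cong_pow) (simp add: bose_modulus_def cong_iff_dvd_diff)
  ultimately show ?thesis
    by (metis power_one)
qed

text \<open>
  Negative powers of \<open>p\<close> are absorbed by the previous lemma, so the relation can be put into a form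
  that is symmetric in \<open>b\<close> and \<open>e\<close> and uses natural exponents only.
\<close>

lemma frobenius_conjugates:
  assumes "cong_power_multiple p bose_modulus b e"
  obtains i i' where "[int p ^ i * int p ^ i' = 1] (mod bose_modulus)"
    "pw b = pw (int (p ^ i) * e)" "pw e = pw (int (p ^ i') * b)"
proof -
  have inverse: "[y = int p ^ j' * x] (mod bose_modulus)"
    if "[int p ^ j * int p ^ j' = 1] (mod bose_modulus)" "[x = int p ^ j * y] (mod bose_modulus)"
    for j j' :: nat and x y :: int
  proof -
    have "[int p ^ j' * x = int p ^ j' * (int p ^ j * y)] (mod bose_modulus)"
      using that(2) by (rule cong_scalar_left)
    also have "int p ^ j' * (int p ^ j * y) = int p ^ j * int p ^ j' * y"
      by (simp add: mult_ac)
    also have "[\<dots> = 1 * y] (mod bose_modulus)"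
      using that(1) by (rule cong_scalar_right)
    finally show ?thesis
      by (simp add: cong_sym_eq)
  qed
  obtain i where "[b = int p ^ i * e] (mod bose_modulus) \<or> [e = int p ^ i * b] (mod bose_modulus)"
    using assms unfolding cong_power_multiple_def by (metis cong_sym)
  then show thesis
  proof
    assume be: "[b = int p ^ i * e] (mod bose_modulus)"
    obtain i' where i': "[int p ^ i * int p ^ i' = 1] (mod bose_modulus)"
      using frobenius_inverse by blast
    show thesis
      using that[OF i'] be inverse[OF i' be] by (simp add: pw_eq_iff)
  next
    assume eb: "[e = int p ^ i * b] (mod bose_modulus)"
    obtain i' where i': "[int p ^ i * int p ^ i' = 1] (mod bose_modulus)"
      using frobenius_inverse by blast
    show thesis
      using that[of i' i] i' eb inverse[OF i' eb] by (simp add: pw_eq_iff mult.commute)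
  qed
qed

section \<open>Bose--Chowla sets\<close>

lemma mem_BoseCh: "a mod bose_modulus \<in> BoseCh K F \<theta> n q b \<longleftrightarrow> (\<exists>v\<in>F. pw a = pw b \<oplus> v)"
  unfolding BoseCh_def pw_def[symmetric] bose_modulus_def[symmetric]
  using bose_modulus_pos by simp

lemma BoseCh_subset: "BoseCh K F \<theta> n q b \<subseteq> {0..<bose_modulus}"
  unfolding BoseCh_def bose_modulus_def by blast

lemma BoseCh_affinely_equivalentI:
  assumes "[d * d' = 1] (mod bose_modulus)" and "[d * s' + s = 0] (mod bose_modulus)"
    and be: "\<And>a v. v \<in> F \<Longrightarrow> pw a = pw b \<oplus> v \<Longrightarrow> \<exists>w\<in>F. pw (d * a + s) = pw e \<oplus> w"
    and eb: "\<And>a v. v \<in> F \<Longrightarrow> pw a = pw e \<oplus> v \<Longrightarrow> \<exists>w\<in>F. pw (d' * a + s') = pw b \<oplus> w"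
  shows "affinely_equivalent bose_modulus (BoseCh K F \<theta> n q b) (BoseCh K F \<theta> n q e)"
proof (rule affinely_equivalentI_inverse[OF BoseCh_subset BoseCh_subset assms(1,2)])
  have mem: "\<exists>v\<in>F. pw a = pw c \<oplus> v" if "a \<in> BoseCh K F \<theta> n q c" for a c
    using that unfolding BoseCh_def pw_def by blast
  show "(d * a + s) mod bose_modulus \<in> BoseCh K F \<theta> n q e" if "a \<in> BoseCh K F \<theta> n q b" for a
    using mem[OF that] be unfolding mem_BoseCh by blast
  show "(d' * a + s') mod bose_modulus \<in> BoseCh K F \<theta> n q b" if "a \<in> BoseCh K F \<theta> n q e" for a
    using mem[OF that] eb unfolding mem_BoseCh by blast
qed

lemma BoseCh_scaling_step:
  assumes "singer_modulus dvd c" and v: "v \<in> F" and a: "pw a = pw b \<oplus> v"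
  shows "\<exists>w\<in>F. pw (a + c) = pw (b + c) \<oplus> w"
proof
  have c: "pw c \<in> F"
    using assms(1) by (simp add: pw_in_F_iff)
  show "v \<otimes> pw c \<in> F"
    using v c by simp
  show "pw (a + c) = pw (b + c) \<oplus> v \<otimes> pw c"
    using v by (simp add: pw_add a l_distr)
qed

text \<open>
  Multiplying \<open>\<theta>\<^sup>b + F\<close> by the element \<open>\<theta>\<^sup>e\<^sup>-\<^sup>b\<close> of \<open>F\<close> gives \<open>\<theta>\<^sup>e + F\<close>.
\<close>

lemma BoseCh_scaling:
  assumes "[b = e] (mod singer_modulus)"
  shows "affinely_equivalent bose_modulus (BoseCh K F \<theta> n q b) (BoseCh K F \<theta> n q e)"
proof (rule BoseCh_affinely_equivalentI[of 1 1 "b - e" "e - b"])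
  have dvd: "singer_modulus dvd e - b" "singer_modulus dvd b - e"
    using assms cong_sym[OF assms] by (simp_all add: cong_iff_dvd_diff)
  show "\<exists>w\<in>F. pw (1 * a + (e - b)) = pw e \<oplus> w" if "v \<in> F" "pw a = pw b \<oplus> v" for a v
    using BoseCh_scaling_step[OF dvd(1) that] by simp
  show "\<exists>w\<in>F. pw (1 * a + (b - e)) = pw b \<oplus> w" if "v \<in> F" "pw a = pw e \<oplus> v" for a v
    using BoseCh_scaling_step[OF dvd(2) that] by simp
qed simp_all

lemma BoseCh_translation:
  assumes "pw b \<ominus> pw e \<in> F"
  shows "affinely_equivalent bose_modulus (BoseCh K F \<theta> n q b) (BoseCh K F \<theta> n q e)"
proof (rule BoseCh_affinely_equivalentI[of 1 1 0 0])
  define z where "z = pw b \<ominus> pw e"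
  have z: "z \<in> F"
    using assms by (simp add: z_def)
  have b: "pw b = pw e \<oplus> z"
    unfolding z_def by (simp add: minus_eq a_lcomm r_neg)
  show "\<exists>w\<in>F. pw (1 * a + 0) = pw e \<oplus> w" if "v \<in> F" "pw a = pw b \<oplus> v" for a v
    using that z by (intro bexI[of _ "z \<oplus> v"]) (simp_all add: b a_assoc)
  show "\<exists>w\<in>F. pw (1 * a + 0) = pw b \<oplus> w" if "v \<in> F" "pw a = pw e \<oplus> v" for a v
  proof
    have "pw e \<in> carrier K" "z \<in> carrier K" "v \<in> carrier K"
      using z that by simp_all
    then have "pw e \<oplus> v = (pw e \<oplus> z) \<oplus> (v \<ominus> z)"
      by algebra
    then show "pw (1 * a + 0) = pw b \<oplus> (v \<ominus> z)"
      using that by (simp add: b)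
  qed (use z that in simp)
qed simp_all

lemma BoseCh_frobenius_step:
  assumes v: "v \<in> F" and a: "pw a = pw b \<oplus> v"
  shows "\<exists>w\<in>F. pw (int (p ^ i) * a + 0) = pw (int (p ^ i) * b) \<oplus> w"
proof
  show "v [^] (p ^ i) \<in> F"
    using v by simp
  show "pw (int (p ^ i) * a + 0) = pw (int (p ^ i) * b) \<oplus> v [^] (p ^ i)"
    using v unfolding add_0_right pw_mult_nat a by (intro frobenius_power_add) simp_all
qed

lemma BoseCh_frobenius:
  assumes "cong_power_multiple p bose_modulus b e"
  shows "affinely_equivalent bose_modulus (BoseCh K F \<theta> n q b) (BoseCh K F \<theta> n q e)"
proof -
  obtain i i' where ii': "[int p ^ i * int p ^ i' = 1] (mod bose_modulus)"
    and b: "pw b = pw (int (p ^ i) * e)" and e: "pw e = pw (int (p ^ i') * b)"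
    using frobenius_conjugates[OF assms] .
  show ?thesis
  proof (rule BoseCh_affinely_equivalentI[of "int (p ^ i')" "int (p ^ i)" 0 0])
    show "[int (p ^ i') * int (p ^ i) = 1] (mod bose_modulus)"
      using ii' by (simp add: mult.commute)
  qed (simp, use BoseCh_frobenius_step[of _ _ b i'] BoseCh_frobenius_step[of _ _ e i] in
      \<open>unfold e[symmetric] b[symmetric], blast+\<close>)
qed

section \<open>Singer sets\<close>

text \<open>
  The defining condition depends on \<open>a\<close> only modulo the Singer modulus, because the plane
  \<open>F \<theta>\<^sup>b + F\<close> is stable under multiplication by \<open>F\<close>.  This lets the later arguments work with
  arbitrary integers in place of least residues.
\<close>

lemma mem_Singer:
  assumes "n = h + 1"
  shows "a mod singer_modulus \<in> Singer K F \<theta> h q b \<longleftrightarrow> (\<exists>u\<in>F. \<exists>v\<in>F. pw a = u \<otimes> pw b \<oplus> v)"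
proof -
  have shift: "\<exists>u\<in>F. \<exists>v\<in>F. pw (a + singer_modulus * j) = u \<otimes> pw b \<oplus> v"
    if a: "\<exists>u\<in>F. \<exists>v\<in>F. pw a = u \<otimes> pw b \<oplus> v" for a j
  proof -
    obtain u v where uv: "u \<in> F" "v \<in> F" "pw a = u \<otimes> pw b \<oplus> v"
      using a by blast
    define c where "c = pw (singer_modulus * j)"
    have c: "c \<in> F"
      by (simp add: c_def pw_in_F_iff)
    have "pw (a + singer_modulus * j) = c \<otimes> u \<otimes> pw b \<oplus> c \<otimes> v"
      using uv c by (simp add: pw_add c_def[symmetric] m_comm[of _ c] r_distr m_assoc)
    then show ?thesis
      using uv c by (intro bexI[of _ "c \<otimes> u"] bexI[of _ "c \<otimes> v"]) simp_all
  qed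
  have "a mod singer_modulus \<in> {0..<singer_modulus}"
    using singer_modulus_pos by simp
  then have "a mod singer_modulus \<in> Singer K F \<theta> h q b
      \<longleftrightarrow> (\<exists>u\<in>F. \<exists>v\<in>F. pw (a mod singer_modulus) = u \<otimes> pw b \<oplus> v)"
    unfolding Singer_def pw_def[symmetric] assms[symmetric] singer_modulus_def[symmetric] by blast
  also have "\<dots> \<longleftrightarrow> (\<exists>u\<in>F. \<exists>v\<in>F. pw a = u \<otimes> pw b \<oplus> v)"
    using shift[of "a mod singer_modulus" "a div singer_modulus"] shift[of a "- (a div singer_modulus)"]
    by (auto simp: minus_mult_div_eq_mod)
  finally show ?thesis .
qed

lemma Singer_subset:
  assumes "n = h + 1"
  shows "Singer K F \<theta> h q b \<subseteq> {0..<singer_modulus}"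
  unfolding Singer_def singer_modulus_def assms[symmetric] by blast

lemma Singer_affinely_equivalentI:
  assumes h: "n = h + 1"
    and "[d * d' = 1] (mod singer_modulus)" and "[d * s' + s = 0] (mod singer_modulus)"
    and be: "\<And>a u v. u \<in> F \<Longrightarrow> v \<in> F \<Longrightarrow> pw a = u \<otimes> pw b \<oplus> v \<Longrightarrow>
      \<exists>u\<in>F. \<exists>v\<in>F. pw (d * a + s) = u \<otimes> pw e \<oplus> v"
    and eb: "\<And>a u v. u \<in> F \<Longrightarrow> v \<in> F \<Longrightarrow> pw a = u \<otimes> pw e \<oplus> v \<Longrightarrow>
      \<exists>u\<in>F. \<exists>v\<in>F. pw (d' * a + s') = u \<otimes> pw b \<oplus> v"
  shows "affinely_equivalent singer_modulus (Singer K F \<theta> h q b) (Singer K F \<theta> h q e)"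
proof (rule affinely_equivalentI_inverse[OF Singer_subset[OF h] Singer_subset[OF h] assms(2,3)])
  have mem: "\<exists>u\<in>F. \<exists>v\<in>F. pw a = u \<otimes> pw c \<oplus> v" if "a \<in> Singer K F \<theta> h q c" for a c
    using that unfolding Singer_def pw_def by blast
  show "(d * a + s) mod singer_modulus \<in> Singer K F \<theta> h q e" if "a \<in> Singer K F \<theta> h q b" for a
    using mem[OF that] be unfolding mem_Singer[OF h] by blast
  show "(d' * a + s') mod singer_modulus \<in> Singer K F \<theta> h q b" if "a \<in> Singer K F \<theta> h q e" for a
    using mem[OF that] eb unfolding mem_Singer[OF h] by blast
qed

lemma Singer_frobenius_step:
  assumes u: "u \<in> F" and v: "v \<in> F" and a: "pw a = u \<otimes> pw b \<oplus> v"
  shows "\<exists>u\<in>F. \<exists>v\<in>F. pw (int (p ^ i) * a + 0) = u \<otimes> pw (int (p ^ i) * b) \<oplus> v"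
proof -
  have "u [^] (p ^ i) \<in> F" "v [^] (p ^ i) \<in> F"
    using u v by simp_all
  have "pw (int (p ^ i) * a + 0) = (u \<otimes> pw b \<oplus> v) [^] (p ^ i)"
    unfolding add_0_right pw_mult_nat a ..
  also have "\<dots> = (u \<otimes> pw b) [^] (p ^ i) \<oplus> v [^] (p ^ i)"
    using u v by (intro frobenius_power_add) simp_all
  also have "(u \<otimes> pw b) [^] (p ^ i) = u [^] (p ^ i) \<otimes> pw (int (p ^ i) * b)"
    using u by (simp only: pw_mult_nat nat_pow_distrib pw_closed F_closed)
  finally have "pw (int (p ^ i) * a + 0) = u [^] (p ^ i) \<otimes> pw (int (p ^ i) * b) \<oplus> v [^] (p ^ i)" .
  then show ?thesis
    using \<open>u [^] (p ^ i) \<in> F\<close> \<open>v [^] (p ^ i) \<in> F\<close> by blast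
qed

lemma Singer_frobenius:
  assumes h: "n = h + 1" and "cong_power_multiple p bose_modulus b e"
  shows "affinely_equivalent singer_modulus (Singer K F \<theta> h q b) (Singer K F \<theta> h q e)"
proof -
  obtain i i' where "[int p ^ i * int p ^ i' = 1] (mod bose_modulus)"
    and b: "pw b = pw (int (p ^ i) * e)" and e: "pw e = pw (int (p ^ i') * b)"
    using frobenius_conjugates[OF assms(2)] .
  moreover have "singer_modulus dvd bose_modulus"
    using singer_modulus_times by (metis dvd_triv_left)
  ultimately have ii': "[int p ^ i * int p ^ i' = 1] (mod singer_modulus)"
    by (meson cong_dvd_modulus)
  show ?thesis
  proof (rule Singer_affinely_equivalentI[OF h, of "int (p ^ i')" "int (p ^ i)" 0 0])
    show "[int (p ^ i') * int (p ^ i) = 1] (mod singer_modulus)"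
      using ii' by (simp add: mult.commute)
  qed (simp, use Singer_frobenius_step[of _ _ _ b i'] Singer_frobenius_step[of _ _ _ e i] in
      \<open>unfold e[symmetric] b[symmetric], blast+\<close>)
qed

text \<open>
  The relation says \<open>(r + t E) B = z - w E\<close> for \<open>B = \<theta>\<^sup>b\<close> and \<open>E = \<theta>\<^sup>e\<close>, so multiplication by
  the denominator \<open>\<theta>\<^sup>s = r + t E\<close> carries \<open>u B + v\<close> into the plane \<open>F E + F\<close>.
\<close>

lemma Singer_moebius_step:
  assumes F: "r \<in> F" "t \<in> F" "w \<in> F" "z \<in> F" "u \<in> F" "v \<in> F"
    and z: "r \<otimes> pw b \<oplus> t \<otimes> (pw e \<otimes> pw b) \<oplus> w \<otimes> pw e = z"
    and s: "pw s = r \<oplus> t \<otimes> pw e"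
    and a: "pw a = u \<otimes> pw b \<oplus> v"
  shows "\<exists>u\<in>F. \<exists>v\<in>F. pw (1 * a + s) = u \<otimes> pw e \<oplus> v"
proof -
  have closed: "v \<otimes> t \<ominus> u \<otimes> w \<in> F" "u \<otimes> z \<oplus> v \<otimes> r \<in> F"
    using F by simp_all
  have K: "r \<in> carrier K" "t \<in> carrier K" "w \<in> carrier K" "u \<in> carrier K" "v \<in> carrier K"
    "pw b \<in> carrier K" "pw e \<in> carrier K"
    using F by simp_all
  have "pw (1 * a + s) = (u \<otimes> pw b \<oplus> v) \<otimes> (r \<oplus> t \<otimes> pw e)"
    by (simp add: pw_add a s)
  also have "\<dots> = (v \<otimes> t \<ominus> u \<otimes> w) \<otimes> pw e
      \<oplus> (u \<otimes> (r \<otimes> pw b \<oplus> t \<otimes> (pw e \<otimes> pw b) \<oplus> w \<otimes> pw e) \<oplus> v \<otimes> r)"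
    using K by algebra
  finally show ?thesis
    unfolding z using closed by blast
qed

lemma linear_in_F_nonzero:
  assumes "x \<in> carrier K" "x \<notin> F" "r \<in> F" "t \<in> F" "\<not> (r = \<zero> \<and> t = \<zero>)"
  shows "r \<oplus> t \<otimes> x \<noteq> \<zero>"
proof
  assume 0: "r \<oplus> t \<otimes> x = \<zero>"
  then have "t \<otimes> x = \<ominus> r"
    using assms by (simp add: sum_zero_eq_neg a_comm)
  then have "t \<otimes> x \<in> F"
    using assms by simp
  then have "t = \<zero>"
    using F_cancel[of t x] assms by blast
  then show False
    using 0 assms by simp
qed

text \<open>
  Lemma \<open>Singer_moebius_step\<close> applies twice, the second time with the roles of \<open>(b, r)\<close> and
  \<open>(e, w)\<close> exchanged, and the product of the two denominators lies in \<open>F\<close>.  This replaces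
  solving a linear system for the inverse transform.
\<close>

lemma Singer_moebius:
  assumes h: "n = h + 1" and b: "pw b \<notin> F" and e: "pw e \<notin> F"
    and F: "r \<in> F" "t \<in> F" "w \<in> F" and rt: "\<not> (r = \<zero> \<and> t = \<zero>)"
    and zF: "r \<otimes> pw b \<oplus> t \<otimes> (pw e \<otimes> pw b) \<oplus> w \<otimes> pw e \<in> F"
  shows "affinely_equivalent singer_modulus (Singer K F \<theta> h q b) (Singer K F \<theta> h q e)"
proof -
  define z where "z = r \<otimes> pw b \<oplus> t \<otimes> (pw e \<otimes> pw b) \<oplus> w \<otimes> pw e"
  have z: "z \<in> F"
    using zF by (simp add: z_def)
  have K: "r \<in> carrier K" "t \<in> carrier K" "w \<in> carrier K" "pw b \<in> carrier K" "pw e \<in> carrier K"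
    using F by simp_all
  have z': "w \<otimes> pw e \<oplus> t \<otimes> (pw b \<otimes> pw e) \<oplus> r \<otimes> pw b = z"
    unfolding z_def using K by algebra
  (* If w and t vanished, the relation would put r pw b, and hence pw b, into F. *)
  have wt: "\<not> (w = \<zero> \<and> t = \<zero>)"
  proof
    assume "w = \<zero> \<and> t = \<zero>"
    then have "r \<otimes> pw b \<in> F"
      using z K by (simp add: z_def)
    then show False
      using F_cancel[of r "pw b"] b rt F \<open>w = \<zero> \<and> t = \<zero>\<close> by simp
  qed
  obtain s where s: "pw s = r \<oplus> t \<otimes> pw e"
    using pw_surj[of "r \<oplus> t \<otimes> pw e"] linear_in_F_nonzero[of "pw e" r t] e F rt by auto
  obtain s' where s': "pw s' = w \<oplus> t \<otimes> pw b"
    using pw_surj[of "w \<oplus> t \<otimes> pw b"] linear_in_F_nonzero[of "pw b" w t] b F wt by auto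
  have "pw (s' + s) = (w \<oplus> t \<otimes> pw b) \<otimes> (r \<oplus> t \<otimes> pw e)"
    by (simp add: pw_add s s')
  also have "\<dots> = r \<otimes> w \<oplus> t \<otimes> (r \<otimes> pw b \<oplus> t \<otimes> (pw e \<otimes> pw b) \<oplus> w \<otimes> pw e)"
    using K by algebra
  also have "\<dots> \<in> F"
    using F z by (simp add: z_def[symmetric])
  finally have ss': "[1 * s' + s = 0] (mod singer_modulus)"
    by (simp add: pw_in_F_iff cong_0_iff)
  show ?thesis
    using Singer_moebius_step[OF F z _ _ z_def[symmetric] s]
      Singer_moebius_step[OF F(3,2,1) z _ _ z' s']
    by (intro Singer_affinely_equivalentI[OF h _ ss', of 1]) simp_all
qed

text \<open>
  Here \<open>\<theta>\<^sup>b = c \<theta>\<^sup>e\<close> with \<open>c\<close> in \<open>F\<close>, a Moebius relation with \<open>r = 1\<close>, \<open>t = 0\<close>, \<open>w = -c\<close>.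
\<close>

lemma Singer_scaling:
  assumes h: "n = h + 1" and b: "pw b \<notin> F" and e: "pw e \<notin> F"
    and be: "[b = e] (mod singer_modulus)"
  shows "affinely_equivalent singer_modulus (Singer K F \<theta> h q b) (Singer K F \<theta> h q e)"
proof -
  have "singer_modulus dvd b - e"
    using be by (simp add: cong_iff_dvd_diff)
  then have c: "pw (b - e) \<in> F"
    by (simp add: pw_in_F_iff)
  have "pw b = pw (b - e) \<otimes> pw e"
    by (simp flip: pw_add)
  then have "\<one> \<otimes> pw b \<oplus> \<zero> \<otimes> (pw e \<otimes> pw b) \<oplus> \<ominus> pw (b - e) \<otimes> pw e = \<zero>"
    by (simp add: l_minus r_neg)
  then show ?thesis
    using c by (intro Singer_moebius[OF h b e, of \<one> \<zero> "\<ominus> pw (b - e)"]) simp_all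
qed

lemma Singer_translation:
  assumes h: "n = h + 1" and b: "pw b \<notin> F" and e: "pw e \<notin> F" and be: "pw b \<ominus> pw e \<in> F"
  shows "affinely_equivalent singer_modulus (Singer K F \<theta> h q b) (Singer K F \<theta> h q e)"
proof -
  have "\<one> \<otimes> pw b \<oplus> \<zero> \<otimes> (pw e \<otimes> pw b) \<oplus> \<ominus> \<one> \<otimes> pw e = pw b \<ominus> pw e"
    by (simp add: l_minus minus_eq)
  then show ?thesis
    using be by (intro Singer_moebius[OF h b e, of \<one> \<zero> "\<ominus> \<one>"]) simp_all
qed

end

section \<open>The equivalence criteria\<close>

theorem theorem4:
  fixes h p q :: nat
  assumes "h \<ge> 2" and "Factorial_Ring.prime p" and "\<exists>k\<ge>1. q = p ^ k"
  shows
    "(\<forall>(K :: ('a, 'm) ring_scheme) F \<theta> (b::int) (e::int).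
        finite_field_generator K F \<theta> q h \<longrightarrow>
        algebraic_degree K F (\<theta> [^]\<^bsub>units_of K\<^esub> b) = h \<longrightarrow>
        algebraic_degree K F (\<theta> [^]\<^bsub>units_of K\<^esub> e) = h \<longrightarrow>
        ([b = e] (mod ((int q ^ h - 1) div (int q - 1))) \<or>
         \<theta> [^]\<^bsub>units_of K\<^esub> b \<ominus>\<^bsub>K\<^esub> \<theta> [^]\<^bsub>units_of K\<^esub> e \<in> F \<or>
         cong_power_multiple p (int q ^ h - 1) b e) \<longrightarrow>
        affinely_equivalent (int q ^ h - 1) (BoseCh K F \<theta> h q b) (BoseCh K F \<theta> h q e))
     \<and>
     (\<forall>(L :: ('b, 'n) ring_scheme) F \<theta> (b::int) (e::int).
        finite_field_generator L F \<theta> q (h + 1) \<longrightarrow>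
        algebraic_degree L F (\<theta> [^]\<^bsub>units_of L\<^esub> b) = h + 1 \<longrightarrow>
        algebraic_degree L F (\<theta> [^]\<^bsub>units_of L\<^esub> e) = h + 1 \<longrightarrow>
        ([b = e] (mod ((int q ^ (h + 1) - 1) div (int q - 1))) \<or>
         cong_power_multiple p (int q ^ (h + 1) - 1) b e \<or>
         \<theta> [^]\<^bsub>units_of L\<^esub> b \<ominus>\<^bsub>L\<^esub> \<theta> [^]\<^bsub>units_of L\<^esub> e \<in> F \<or>
         (\<exists>r\<in>F. \<exists>t\<in>F. \<exists>w\<in>F. \<not> (r = \<zero>\<^bsub>L\<^esub> \<and> t = \<zero>\<^bsub>L\<^esub>) \<and>
            r \<otimes>\<^bsub>L\<^esub> \<theta> [^]\<^bsub>units_of L\<^esub> b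
              \<oplus>\<^bsub>L\<^esub> t \<otimes>\<^bsub>L\<^esub> \<theta> [^]\<^bsub>units_of L\<^esub> (e + b)
              \<oplus>\<^bsub>L\<^esub> w \<otimes>\<^bsub>L\<^esub> \<theta> [^]\<^bsub>units_of L\<^esub> e \<in> F)) \<longrightarrow>
        affinely_equivalent ((int q ^ (h + 1) - 1) div (int q - 1))
          (Singer L F \<theta> h q b) (Singer L F \<theta> h q e))"
proof -
  obtain k where k: "k \<ge> 1" "q = p ^ k"
    using assms(3) by blast
  have bose: "affinely_equivalent (int q ^ h - 1) (BoseCh K F \<theta> h q b) (BoseCh K F \<theta> h q e)"
    if K: "finite_field_generator K F \<theta> q h"
      and "[b = e] (mod ((int q ^ h - 1) div (int q - 1))) \<or>
         \<theta> [^]\<^bsub>units_of K\<^esub> b \<ominus>\<^bsub>K\<^esub> \<theta> [^]\<^bsub>units_of K\<^esub> e \<in> F \<or>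
         cong_power_multiple p (int q ^ h - 1) b e"
    for K :: "('a, 'm) ring_scheme" and F \<theta> b e
  proof -
    interpret prime_power_field_generator K F \<theta> q h p k
      using K assms(2) k by (simp add: prime_power_field_generator_def prime_power_field_generator_axioms_def)
    show ?thesis
      using that(2) BoseCh_scaling BoseCh_translation BoseCh_frobenius
      unfolding singer_modulus_def bose_modulus_def pw_def by blast
  qed
  have singer: "affinely_equivalent ((int q ^ (h + 1) - 1) div (int q - 1))
      (Singer L F \<theta> h q b) (Singer L F \<theta> h q e)"
    if L: "finite_field_generator L F \<theta> q (h + 1)"
      and deg_b: "algebraic_degree L F (\<theta> [^]\<^bsub>units_of L\<^esub> b) = h + 1"
      and deg_e: "algebraic_degree L F (\<theta> [^]\<^bsub>units_of L\<^esub> e) = h + 1"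
      and cases: "[b = e] (mod ((int q ^ (h + 1) - 1) div (int q - 1))) \<or>
         cong_power_multiple p (int q ^ (h + 1) - 1) b e \<or>
         \<theta> [^]\<^bsub>units_of L\<^esub> b \<ominus>\<^bsub>L\<^esub> \<theta> [^]\<^bsub>units_of L\<^esub> e \<in> F \<or>
         (\<exists>r\<in>F. \<exists>t\<in>F. \<exists>w\<in>F. \<not> (r = \<zero>\<^bsub>L\<^esub> \<and> t = \<zero>\<^bsub>L\<^esub>) \<and>
            r \<otimes>\<^bsub>L\<^esub> \<theta> [^]\<^bsub>units_of L\<^esub> b
              \<oplus>\<^bsub>L\<^esub> t \<otimes>\<^bsub>L\<^esub> \<theta> [^]\<^bsub>units_of L\<^esub> (e + b)
              \<oplus>\<^bsub>L\<^esub> w \<otimes>\<^bsub>L\<^esub> \<theta> [^]\<^bsub>units_of L\<^esub> e \<in> F)"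
    for L :: "('b, 'n) ring_scheme" and F \<theta> b e
  proof -
    interpret prime_power_field_generator L F \<theta> q "h + 1" p k
      using L assms(2) k by (simp add: prime_power_field_generator_def prime_power_field_generator_axioms_def)
    have b: "pw b \<notin> F" and e: "pw e \<notin> F"
      using deg_b deg_e assms(1) by (auto simp: pw_def intro!: not_in_F_of_degree)
    show ?thesis
      using cases Singer_scaling[OF refl b e] Singer_frobenius[OF refl, of b e]
        Singer_translation[OF refl b e] Singer_moebius[OF refl b e]
      unfolding singer_modulus_def[symmetric]
      unfolding bose_modulus_def[symmetric] pw_def[symmetric] pw_add
      by blast
  qed
  show ?thesis
    using bose singer by blast
qed

end
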